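(* Let $T\subset\mathbb R^d$ be a nondegenerate $d$-simplex with barycentric coordinates $\lambda=(\lambda_0,\dots,\lambda_d)$, let $k\ge0$ be an integer, and for $\beta\in\mathbb T_k^d$ let $B^\beta=\frac{k!}{\beta!}\lambda^\beta$ be the Bernstein polynomial. Then for every integer $0\le r\le k$, the $r$-th order derivative of $B^\beta$ is $$\nabla^rB^\beta=\sum_{\alpha\in\mathbb T_r^d,\ \alpha\le\beta}\frac{r!\,k!}{(k-r)!\,\alpha!}\,\operatorname{sym}\big((\nabla\lambda)^{\otimes\alpha}\big)\,B^{\beta-\alpha},$$ where $\nabla\lambda=(\nabla\lambda_0,\nabla\lambda_1,\dots,\nabla\lambda_d)$.
   Context: $\mathbb T_j^d=\{\alpha\in\mathbb N^{d+1}:\alpha_0+\dots+\alpha_d=j\}$ (with $0\in\mathbb N$), $\alpha!=\alpha_0!\cdots\alpha_d!$, $\lambda^\alpha=\lambda_0^{\alpha_0}\cdots\lambda_d^{\alpha_d}$, and $\alpha\le\beta$ is componentwise. For $\mu\in\mathbb T_j^d$, $B^\mu=\frac{j!}{\mu!}\lambda^\mu$; so $B^{\beta-\alpha}$ is the Bernstein polynomial of degree $k-r$. $\nabla^rv\in(\mathbb R^d)^{\otimes r}$ is the tensor of all $r$-th order partial derivatives. $(\nabla\lambda)^{\otimes\alpha}=(\nabla\lambda_0)^{\otimes\alpha_0}\otimes\cdots\otimes(\nabla\lambda_d)^{\otimes\alpha_d}$, and for $\boldsymbol\tau\in(\mathbb R^d)^{\otimes r}$, $\operatorname{sym}(\boldsymbol\tau)_{i_1\cdots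 i_r}=\frac1{r!}\sum_{\sigma}\tau_{i_{\sigma(1)}\cdots i_{\sigma(r)}}$, the sum being over all permutations $\sigma$ of $\{1,\dots,r\}$. *)

theory Defs
  imports "HOL-Analysis.Analysis" "HOL-Combinatorics.Permutations"
begin

text \<open>
  A multi-index with entries \<open>\<alpha> 0, \<dots>, \<alpha> d\<close> is a function on \<open>nat\<close> that vanishes beyond \<open>d\<close>;
  thus \<open>multi_indices d j\<close> is finite, and the pointwise order of functions is the componentwise
  order of multi-indices.
\<close>

definition midx_sum :: "nat \<Rightarrow> (nat \<Rightarrow> nat) \<Rightarrow> nat" where
  "midx_sum d \<alpha> = (\<Sum>i\<le>d. \<alpha> i)"

definition multi_indices :: "nat \<Rightarrow> nat \<Rightarrow> (nat \<Rightarrow> nat) set" where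
  "multi_indices d j = {\<alpha>. (\<forall>i>d. \<alpha> i = 0) \<and> midx_sum d \<alpha> = j}"

definition midx_fact :: "nat \<Rightarrow> (nat \<Rightarrow> nat) \<Rightarrow> real" where
  "midx_fact d \<alpha> = (\<Prod>i\<le>d. fact (\<alpha> i))"

definition midx_diff :: "(nat \<Rightarrow> nat) \<Rightarrow> (nat \<Rightarrow> nat) \<Rightarrow> nat \<Rightarrow> nat" where
  "midx_diff \<beta> \<alpha> = (\<lambda>i. \<beta> i - \<alpha> i)"

text \<open>
  Barycentric coordinates with respect to the points \<open>v 0, \<dots>, v d\<close>, as functions on the whole
  space. If these points are the vertices of a nondegenerate simplex, such functions exist, are
  unique for the indices up to \<open>d\<close>, and are affine.
\<close>

definition barycentric_coordinates ::
    "(nat \<Rightarrow> real^'d) \<Rightarrow> (nat \<Rightarrow> real^'d \<Rightarrow> real) \<Rightarrow> bool" where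
  "barycentric_coordinates v lam \<longleftrightarrow>
     (\<forall>x. (\<Sum>i\<le>CARD('d). lam i x) = 1 \<and> (\<Sum>i\<le>CARD('d). lam i x *\<^sub>R v i) = x)"

definition bernstein ::
    "(nat \<Rightarrow> real^'d \<Rightarrow> real) \<Rightarrow> (nat \<Rightarrow> nat) \<Rightarrow> real^'d \<Rightarrow> real" where
  "bernstein lam \<mu> x =
     fact (midx_sum CARD('d) \<mu>) / midx_fact CARD('d) \<mu> * (\<Prod>i\<le>CARD('d). lam i x ^ \<mu> i)"

definition partial_deriv :: "'d \<Rightarrow> (real^'d \<Rightarrow> real) \<Rightarrow> real^'d \<Rightarrow> real" where
  "partial_deriv i f x = deriv (\<lambda>t. f (x + t *\<^sub>R axis i 1)) 0"

definition gradient :: "(real^'d \<Rightarrow> real) \<Rightarrow> real^'d \<Rightarrow> real^'d" where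
  "gradient f x = (\<chi> i. partial_deriv i f x)"

text \<open>
  A tensor of order \<open>r\<close> over \<open>real^'d\<close> is given by its components, indexed by the lists
  \<open>[i\<^sub>1, \<dots>, i\<^sub>r]\<close> of length \<open>r\<close>; its values on lists of any other length are irrelevant.
\<close>

type_synonym 'd tensor = "'d list \<Rightarrow> real"

text \<open>
  The tensors of partial derivatives of all orders at once: on lists of length \<open>r\<close>,
  \<open>nabla f x\<close> is the tensor of all \<open>r\<close>-th order partial derivatives of \<open>f\<close> at \<open>x\<close>.
\<close>

fun iterated_partial :: "'d list \<Rightarrow> (real^'d \<Rightarrow> real) \<Rightarrow> real^'d \<Rightarrow> real" where
  "iterated_partial [] f = f"
| "iterated_partial (i # ix) f = partial_deriv i (iterated_partial ix f)"

definition nabla :: "(real^'d \<Rightarrow> real) \<Rightarrow> real^'d \<Rightarrow> 'd tensor" where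
  "nabla f x = (\<lambda>ix. iterated_partial ix f x)"

text \<open>The tensor product of a list of vectors, a tensor of order \<open>length vs\<close>.\<close>

definition tensor_of_vectors :: "(real^'d) list \<Rightarrow> 'd tensor" where
  "tensor_of_vectors vs = (\<lambda>ix. \<Prod>m<length vs. (vs ! m) $ (ix ! m))"

text \<open>\<open>g 0\<^sup>\<otimes>\<^sup>\<alpha>\<^sup>0 \<otimes> \<dots> \<otimes> g d\<^sup>\<otimes>\<^sup>\<alpha>\<^sup>d\<close>, where the exponents are \<open>\<alpha> 0, \<dots>, \<alpha> d\<close>.\<close>

definition tensor_power :: "(nat \<Rightarrow> real^'d) \<Rightarrow> (nat \<Rightarrow> nat) \<Rightarrow> 'd tensor" where
  "tensor_power g \<alpha> =
     tensor_of_vectors (concat (map (\<lambda>i. replicate (\<alpha> i) (g i)) [0..<Suc CARD('d)]))"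

text \<open>Note that \<open>permute_list \<sigma> ix ! m = ix ! \<sigma> m\<close>; positions are numbered from 0.\<close>

definition sym_tensor :: "nat \<Rightarrow> 'd tensor \<Rightarrow> 'd tensor" where
  "sym_tensor r \<tau> =
     (\<lambda>ix. 1 / fact r * (\<Sum>\<sigma> | \<sigma> permutes {..<r}. \<tau> (permute_list \<sigma> ix)))"

end

theory Submission
  imports Defs "HOL-Combinatorics.Multiset_Permutations"
begin

text \<open>
  Barycentric coordinates are affine, so their gradients \<open>g\<^sub>i\<close> do not depend on the point. Hence it
  is natural to work with the monomials \<open>\<lambda>\<^sup>\<beta> / \<beta>!\<close>: by the product rule, differentiation along the
  \<open>j\<close>-th axis turns \<open>\<lambda>\<^sup>\<beta> / \<beta>!\<close> into the sum of \<open>(g\<^sub>l)\<^sub>j \<lambda>\<^sup>\<gamma> / \<gamma>!\<close> with \<open>\<gamma> = \<beta> - e\<^sub>l\<close>, over those \<open>l\<close>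
  for which \<open>\<gamma>\<close> is still a multi-index, with no combinatorial factor. Iterating this \<open>r\<close> times gives a sum over all
  words \<open>l\<^sub>1 \<dots> l\<^sub>r\<close> in the indices \<open>0, \<dots>, d\<close> whose letter counts are bounded by \<open>\<beta>\<close>; the summand is
  a component of \<open>g\<^sub>l\<^sub>1 \<otimes> \<dots> \<otimes> g\<^sub>l\<^sub>r\<close> times the scaled monomial that is left
  (\<open>iterated_partial_scaled_monomial\<close>).

  The monomial that is left depends only on the letter counts \<open>\<alpha>\<close> of the word, so the words are
  grouped by \<open>\<alpha>\<close>. The words with counts \<open>\<alpha>\<close> are the rearrangements of the word
  \<open>0 \<dots> 0 1 \<dots> 1 \<dots> d \<dots> d\<close> underlying \<open>g\<^sup>\<otimes>\<^sup>\<alpha>\<close>, and each of them arises from exactly \<open>\<alpha>!\<close> of the \<open>r!\<close>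
  permutations of the positions (\<open>sum_permute_list\<close>). The sum over a group is therefore
  \<open>r! / \<alpha>!\<close> times a component of the symmetrization of \<open>g\<^sup>\<otimes>\<^sup>\<alpha>\<close> (\<open>sym_tensor_of_vectors\<close>). The
  factors \<open>k!\<close> and \<open>(k - r)!\<close> come from passing between scaled monomials and Bernstein polynomials.
\<close>


section \<open>Sums over permutations of a list\<close>

text \<open>
  Composition with a fixed permutation carries one fibre of \<open>\<sigma> \<mapsto> permute_list \<sigma> xs\<close> bijectively onto
  any other, so all fibres have the same size, and this size is found by counting both sides.
\<close>

lemma sum_permute_list:
  fixes f :: "'a list \<Rightarrow> 'b::comm_semiring_1"
  shows "(\<Sum>\<sigma> | \<sigma> permutes {..<length xs}. f (permute_list \<sigma> xs)) =
    of_nat (\<Prod>x\<in>set xs. fact (count (mset xs) x)) *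
      (\<Sum>ys\<in>permutations_of_multiset (mset xs). f ys)"
proof -
  let ?S = "{\<sigma>. \<sigma> permutes {..<length xs}}"
  let ?R = "permutations_of_multiset (mset xs)"
  define F where "F ys = {\<sigma> \<in> ?S. permute_list \<sigma> xs = ys}" for ys
  define N where "N = card (F xs)"
  have finS: "finite ?S"
    by (simp add: finite_permutations)
  have image: "(\<lambda>\<sigma>. permute_list \<sigma> xs) ` ?S \<subseteq> ?R"
    by (auto simp: permutations_of_multiset_def)
  have cardF: "card (F ys) = N" if "ys \<in> ?R" for ys
  proof -
    have "mset ys = mset xs"
      using that by (simp add: permutations_of_multiset_def)
    then obtain \<tau> where \<tau>: "\<tau> permutes {..<length xs}" "permute_list \<tau> xs = ys"
      by (rule mset_eq_permutation)
    have \<tau>': "inv \<tau> permutes {..<length xs}"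
      using \<tau>(1) by (rule permutes_inv)
    have ys_back: "permute_list (inv \<tau>) ys = xs"
      using permute_list_compose[OF \<tau>', of \<tau>] \<tau> by (simp add: permutes_inv_o)
    have "bij_betw (\<lambda>\<sigma>. \<sigma> \<circ> \<tau>) (F xs) (F ys)"
    proof (rule bij_betw_byWitness[where f' = "\<lambda>\<sigma>. \<sigma> \<circ> inv \<tau>"])
      show "\<forall>\<sigma>\<in>F xs. (\<sigma> \<circ> \<tau>) \<circ> inv \<tau> = \<sigma>" "\<forall>\<sigma>\<in>F ys. (\<sigma> \<circ> inv \<tau>) \<circ> \<tau> = \<sigma>"
        using \<tau>(1) by (simp_all add: comp_assoc permutes_inv_o)
      show "(\<lambda>\<sigma>. \<sigma> \<circ> \<tau>) ` F xs \<subseteq> F ys" "(\<lambda>\<sigma>. \<sigma> \<circ> inv \<tau>) ` F ys \<subseteq> F xs"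
        using \<tau> \<tau>' ys_back by (auto simp: F_def permute_list_compose permutes_compose)
    qed
    then show ?thesis
      by (simp add: N_def bij_betw_same_card)
  qed
  have group: "sum h ?S = (\<Sum>ys\<in>?R. sum h (F ys))" for h :: "(nat \<Rightarrow> nat) \<Rightarrow> 'c::comm_monoid_add"
    unfolding F_def by (rule sum.group[OF finS _ image, symmetric]) simp
  have "card ?R * N = fact (length xs)"
    using group[of "\<lambda>_. 1::nat"] cardF by (simp add: card_permutations)
  moreover have "card ?R * (\<Prod>x\<in>set xs. fact (count (mset xs) x)) = fact (length xs)"
    using card_permutations_of_multiset_aux[of "mset xs"] by simp
  ultimately have N: "N = (\<Prod>x\<in>set xs. fact (count (mset xs) x))"
    by (metis fact_nonzero mult_cancel1 mult_eq_0_iff)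
  have "(\<Sum>\<sigma>\<in>?S. f (permute_list \<sigma> xs)) = (\<Sum>ys\<in>?R. \<Sum>\<sigma>\<in>F ys. f ys)"
    unfolding group by (intro sum.cong refl) (simp add: F_def)
  also have "\<dots> = (\<Sum>ys\<in>?R. of_nat N * f ys)"
    by (intro sum.cong refl) (simp add: cardF)
  finally show ?thesis
    by (simp add: N sum_distrib_left)
qed


section \<open>Symmetrized tensor products\<close>

lemma tensor_of_vectors_Cons:
  "tensor_of_vectors (w # ws) (i # ix) = w $ i * tensor_of_vectors ws ix"
  by (simp add: tensor_of_vectors_def prod.lessThan_Suc_shift del: prod.lessThan_Suc)

text \<open>
  Permuting the positions of the index list amounts to the inverse permutation of the vectors. Both
  run over the whole symmetric group, so symmetrization averages over rearrangements of the vectors.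
\<close>

lemma sym_tensor_of_vectors:
  assumes len: "length ix = length js"
  shows "fact (length js) * sym_tensor (length js) (tensor_of_vectors (map g js)) ix =
    of_nat (\<Prod>j\<in>set js. fact (count (mset js) j)) *
      (\<Sum>ls\<in>permutations_of_multiset (mset js). tensor_of_vectors (map g ls) ix)"
proof -
  let ?S = "{\<sigma>. \<sigma> permutes {..<length js}}"
  have move: "tensor_of_vectors (map g js) (permute_list \<sigma> ix) =
      tensor_of_vectors (map g (permute_list (inv \<sigma>) js)) ix" if "\<sigma> \<in> ?S" for \<sigma>
  proof -
    have \<sigma>: "\<sigma> permutes {..<length js}" and \<sigma>': "inv \<sigma> permutes {..<length js}"
      using that by (auto intro: permutes_inv)
    have "tensor_of_vectors (map g js) (permute_list \<sigma> ix) =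
        (\<Prod>m<length js. g (js ! m) $ (ix ! \<sigma> m))"
      using \<sigma> len by (simp add: tensor_of_vectors_def permute_list_nth)
    also have "\<dots> = (\<Prod>m<length js. g (js ! inv \<sigma> m) $ (ix ! \<sigma> (inv \<sigma> m)))"
      using prod.permute[OF \<sigma>', of "\<lambda>m. g (js ! m) $ (ix ! \<sigma> m)"] by (simp add: o_def)
    also have "\<dots> = tensor_of_vectors (map g (permute_list (inv \<sigma>) js)) ix"
      using \<sigma> \<sigma>' by (simp add: tensor_of_vectors_def permute_list_nth permutes_inverses)
    finally show ?thesis .
  qed
  have "fact (length js) * sym_tensor (length js) (tensor_of_vectors (map g js)) ix =
      (\<Sum>\<sigma>\<in>?S. tensor_of_vectors (map g (permute_list (inv \<sigma>) js)) ix)"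
    using move by (simp add: sym_tensor_def)
  also have "\<dots> = (\<Sum>\<sigma>\<in>?S. tensor_of_vectors (map g (permute_list \<sigma> js)) ix)"
    by (rule sum_permutations_inverse[symmetric])
  also have "\<dots> = of_nat (\<Prod>j\<in>set js. fact (count (mset js) j)) *
      (\<Sum>ls\<in>permutations_of_multiset (mset js). tensor_of_vectors (map g ls) ix)"
    by (rule sum_permute_list)
  finally show ?thesis .
qed


section \<open>Multi-indices as letter counts of words\<close>

definition sorted_word :: "nat \<Rightarrow> (nat \<Rightarrow> nat) \<Rightarrow> nat list" where
  "sorted_word d \<alpha> = concat (map (\<lambda>i. replicate (\<alpha> i) i) [0..<Suc d])"

lemma tensor_power_eq_sorted_word:
  fixes g :: "nat \<Rightarrow> real^'d"
  shows "tensor_power g \<alpha> = tensor_of_vectors (map g (sorted_word CARD('d) \<alpha>))"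
  by (simp add: tensor_power_def sorted_word_def map_concat o_def)

lemma count_sorted_word:
  assumes "\<alpha> \<in> multi_indices d r"
  shows "count (mset (sorted_word d \<alpha>)) = \<alpha>"
proof
  fix j
  have "count (mset (concat (map (\<lambda>i. replicate (\<alpha> i) i) [0..<n]))) j = (if j < n then \<alpha> j else 0)" for n
    by (induction n) (auto simp: less_Suc_eq)
  from this[of "Suc d"] show "count (mset (sorted_word d \<alpha>)) j = \<alpha> j"
    using assms unfolding sorted_word_def multi_indices_def by (auto simp del: upt_Suc)
qed

lemma sum_count_mset:
  assumes "finite A" "set js \<subseteq> A"
  shows "(\<Sum>i\<in>A. count (mset js) i) = length js"
  using assms
proof (induction js)
  case (Cons a js)
  have "(\<Sum>i\<in>A. count (mset (a # js)) i) = (\<Sum>i\<in>A. count (mset js) i + (if i = a then 1 else 0))"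
    by (rule sum.cong) auto
  then show ?case
    using Cons by (simp add: sum.distrib)
qed simp

lemma set_sorted_word: "set (sorted_word d \<alpha>) \<subseteq> {..d}"
  by (auto simp: sorted_word_def)

lemma length_sorted_word:
  assumes "\<alpha> \<in> multi_indices d r"
  shows "length (sorted_word d \<alpha>) = r"
  using sum_count_mset[OF _ set_sorted_word, of d \<alpha>] assms
  by (simp add: count_sorted_word[OF assms] multi_indices_def midx_sum_def)

lemma midx_fact_eq_prod_count:
  assumes "\<alpha> \<in> multi_indices d r"
  shows "midx_fact d \<alpha> = of_nat (\<Prod>j\<in>set (sorted_word d \<alpha>). fact (count (mset (sorted_word d \<alpha>)) j))"
proof -
  have "\<alpha> j = 0" if "j \<notin> set (sorted_word d \<alpha>)" for j
    using that count_sorted_word[OF assms] by (metis count_eq_zero_iff set_mset_mset)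
  then have "(\<Prod>j\<in>set (sorted_word d \<alpha>). fact (\<alpha> j)) = midx_fact d \<alpha>"
    unfolding midx_fact_def by (intro prod.mono_neutral_left set_sorted_word) auto
  then show ?thesis
    by (simp add: count_sorted_word[OF assms])
qed

lemma count_mset_in_multi_indices:
  assumes "set js \<subseteq> {..d}"
  shows "count (mset js) \<in> multi_indices d (length js)"
  using assms sum_count_mset[of "{..d}" js]
  by (auto simp: multi_indices_def midx_sum_def count_eq_zero_iff)

lemma words_with_counts:
  assumes "\<alpha> \<in> multi_indices d r"
  shows "permutations_of_multiset (mset (sorted_word d \<alpha>)) =
    {js. set js \<subseteq> {..d} \<and> length js = r \<and> count (mset js) = \<alpha>}"
proof -
  have "mset js = mset (sorted_word d \<alpha>) \<longleftrightarrow> count (mset js) = \<alpha>" for js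
    by (metis count_inject count_sorted_word[OF assms])
  moreover have "set js \<subseteq> {..d} \<and> length js = r" if "mset js = mset (sorted_word d \<alpha>)" for js
    using that mset_eq_setD[OF that] mset_eq_length[OF that] set_sorted_word length_sorted_word[OF assms]
    by simp
  ultimately show ?thesis
    by (auto simp: permutations_of_multiset_def)
qed


section \<open>Barycentric coordinates are affine\<close>

text \<open>
  Both sides, taken for all \<open>i\<close> at once, have sum \<open>1\<close> and represent \<open>x + t *\<^sub>R e\<close> as a combination of
  the vertices; such coefficients are unique because the vertices are affinely independent.
\<close>

lemma barycentric_coordinates_affine:
  fixes v :: "nat \<Rightarrow> real^'d"
  assumes simplex: "int CARD('d) simplex T"
    and bij: "bij_betw v {..CARD('d)} {p. p extreme_point_of T}"
    and bary: "barycentric_coordinates v lam"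
    and "i \<le> CARD('d)"
  shows "lam i (x + t *\<^sub>R e) = lam i x + t * (lam i e - lam i 0)"
proof -
  let ?I = "{..CARD('d)}"
  define c where "c i = lam i (x + t *\<^sub>R e) - lam i x - t * (lam i e - lam i 0)" for i
  obtain C where C: "\<not> affine_dependent C" "T = convex hull C"
    using simplex by (auto simp: simplex_def)
  have "{p. p extreme_point_of T} = C"
    using C by (auto simp: extreme_point_of_convex_hull_affine_independent)
  with bij have bijC: "bij_betw v ?I C"
    by simp
  then have inj: "inj_on v ?I"
    by (rule bij_betw_imp_inj_on)
  have sum1: "(\<Sum>i\<in>?I. lam i y) = 1" and sumv: "(\<Sum>i\<in>?I. lam i y *\<^sub>R v i) = y" for y
    using bary by (auto simp: barycentric_coordinates_def)
  have c0: "(\<Sum>i\<in>?I. c i) = 0"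
    by (simp add: c_def sum_subtractf sum1 flip: sum_distrib_left)
  have "(\<Sum>i\<in>?I. c i *\<^sub>R v i) = (x + t *\<^sub>R e) - x - t *\<^sub>R (e - 0)"
    by (simp only: c_def scaleR_left_diff_distrib sum_subtractf sumv
        scaleR_scaleR[symmetric] scaleR_sum_right[symmetric])
  then have cv: "(\<Sum>i\<in>?I. c i *\<^sub>R v i) = 0"
    by simp
  \<comment> \<open>Transported to the vertex set, \<open>c\<close> is an affine relation between affinely independent points.\<close>
  define U where "U = c \<circ> the_inv_into ?I v"
  have U: "U (v i) = c i" if "i \<in> ?I" for i
    using that by (simp add: U_def the_inv_into_f_f[OF inj])
  have "sum U C = 0" "(\<Sum>p\<in>C. U p *\<^sub>R p) = 0"
    using c0 cv by (simp_all add: sum.reindex_bij_betw[OF bijC, symmetric] U)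
  then have "\<forall>p\<in>C. U p = 0"
    using C(1) affine_dependent_explicit_finite[OF aff_independent_finite[OF C(1)]] by blast
  then have "c i = 0"
    using U[of i] \<open>i \<le> CARD('d)\<close> bijC by (auto dest: bij_betwE)
  then show ?thesis
    by (simp add: c_def)
qed


section \<open>Derivatives of scaled monomials\<close>

text \<open>
  The product is \<open>\<lambda>\<^sup>\<mu> / \<mu>!\<close>, the multivariate analogue of the divided power \<open>x\<^sup>n / n!\<close>, whose
  derivative is the preceding divided power.
\<close>

definition scaled_monomial ::
    "(nat \<Rightarrow> real^'d \<Rightarrow> real) \<Rightarrow> (nat \<Rightarrow> nat) \<Rightarrow> real^'d \<Rightarrow> real" where
  "scaled_monomial lam \<mu> x = (\<Prod>i\<le>CARD('d). lam i x ^ \<mu> i / fact (\<mu> i))"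

lemma bernstein_eq_scaled_monomial:
  fixes lam :: "nat \<Rightarrow> real^'d \<Rightarrow> real"
  assumes "midx_sum CARD('d) \<mu> = k"
  shows "bernstein lam \<mu> x = fact k * scaled_monomial lam \<mu> x"
  using assms by (simp add: bernstein_def scaled_monomial_def midx_fact_def prod_dividef)

lemma scaled_monomial_has_derivative:
  fixes lam :: "nat \<Rightarrow> real^'d \<Rightarrow> real"
  assumes aff: "\<And>i t. i \<le> CARD('d) \<Longrightarrow> lam i (x + t *\<^sub>R e) = lam i x + t * G i"
  shows "((\<lambda>t. scaled_monomial lam \<mu> (x + t *\<^sub>R e)) has_real_derivative
    (\<Sum>l | l \<le> CARD('d) \<and> 0 < \<mu> l. G l * scaled_monomial lam (\<mu>(l := \<mu> l - 1)) x)) (at 0)"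
proof -
  let ?I = "{..CARD('d)}"
  define D where
    "D l = (if 0 < \<mu> l then G l * (lam l x ^ (\<mu> l - 1) / fact (\<mu> l - 1)) else 0)" for l
  have factor: "((\<lambda>t. (lam l x + t * G l) ^ \<mu> l / fact (\<mu> l)) has_real_derivative D l) (at 0)" for l
  proof (cases "\<mu> l")
    case (Suc n)
    have "((\<lambda>t. (lam l x + t * G l) ^ Suc n / fact (Suc n)) has_real_derivative
        of_nat (Suc n) * ((lam l x + 0 * G l) ^ n * G l) / fact (Suc n)) (at 0)"
      by (rule DERIV_cdivide) (rule derivative_eq_intros | simp)+
    moreover have "of_nat (Suc n) * ((lam l x + 0 * G l) ^ n * G l) / fact (Suc n) = D l"
      by (simp add: D_def Suc del: of_nat_Suc)
    ultimately show ?thesis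
      by (simp only: Suc)
  qed (simp add: D_def)
  have "((\<lambda>t. \<Prod>l\<in>?I. (lam l x + t * G l) ^ \<mu> l / fact (\<mu> l)) has_real_derivative
      (\<Sum>l\<in>?I. D l * (\<Prod>i\<in>?I - {l}. (lam i x + 0 * G i) ^ \<mu> i / fact (\<mu> i)))) (at 0)"
    by (intro has_field_derivative_prod factor)
  moreover have "(\<lambda>t. \<Prod>l\<in>?I. (lam l x + t * G l) ^ \<mu> l / fact (\<mu> l)) =
      (\<lambda>t. scaled_monomial lam \<mu> (x + t *\<^sub>R e))"
    by (simp add: scaled_monomial_def aff)
  moreover have "(\<Sum>l\<in>?I. D l * (\<Prod>i\<in>?I - {l}. (lam i x + 0 * G i) ^ \<mu> i / fact (\<mu> i))) =
      (\<Sum>l | l \<le> CARD('d) \<and> 0 < \<mu> l. G l * scaled_monomial lam (\<mu>(l := \<mu> l - 1)) x)"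
  proof (rule sum.mono_neutral_cong_right)
    show "\<forall>l\<in>?I - {l. l \<le> CARD('d) \<and> 0 < \<mu> l}.
        D l * (\<Prod>i\<in>?I - {l}. (lam i x + 0 * G i) ^ \<mu> i / fact (\<mu> i)) = 0"
      by (simp add: D_def)
    fix l assume l: "l \<in> {l. l \<le> CARD('d) \<and> 0 < \<mu> l}"
    have "scaled_monomial lam (\<mu>(l := \<mu> l - 1)) x =
        lam l x ^ (\<mu> l - 1) / fact (\<mu> l - 1) * (\<Prod>i\<in>?I - {l}. lam i x ^ \<mu> i / fact (\<mu> i))"
      unfolding scaled_monomial_def using l by (subst prod.remove[of _ l]) auto
    then show "D l * (\<Prod>i\<in>?I - {l}. (lam i x + 0 * G i) ^ \<mu> i / fact (\<mu> i)) =
        G l * scaled_monomial lam (\<mu>(l := \<mu> l - 1)) x"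
      using l by (simp add: D_def)
  qed auto
  ultimately show ?thesis
    by simp
qed

definition admissible_words :: "nat \<Rightarrow> (nat \<Rightarrow> nat) \<Rightarrow> nat \<Rightarrow> nat list set" where
  "admissible_words d \<beta> r = {js. set js \<subseteq> {..d} \<and> length js = r \<and> count (mset js) \<le> \<beta>}"

lemma finite_admissible_words: "finite (admissible_words d \<beta> r)"
  by (rule finite_subset[OF _ finite_lists_length_eq[of "{..d}" r]]) (auto simp: admissible_words_def)

lemma count_mset_admissible_words:
  "(\<lambda>js. count (mset js)) ` admissible_words d \<beta> r = {\<alpha>. \<alpha> \<in> multi_indices d r \<and> \<alpha> \<le> \<beta>}"
proof (intro equalityI subsetI)
  fix \<alpha> assume "\<alpha> \<in> {\<alpha>. \<alpha> \<in> multi_indices d r \<and> \<alpha> \<le> \<beta>}"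
  then have "\<alpha> = count (mset (sorted_word d \<alpha>))" "sorted_word d \<alpha> \<in> admissible_words d \<beta> r"
    by (auto simp: admissible_words_def count_sorted_word length_sorted_word
        dest: subsetD[OF set_sorted_word])
  then show "\<alpha> \<in> (\<lambda>js. count (mset js)) ` admissible_words d \<beta> r"
    by (rule image_eqI)
qed (auto simp: admissible_words_def count_mset_in_multi_indices)

text \<open>
  A letter can be put in front of an admissible word exactly if the remaining monomial still contains
  the corresponding coordinate, which is when the product rule yields a term for this letter.
\<close>

lemma admissible_words_Suc:
  "bij_betw (\<lambda>(js, l). l # js)
     (SIGMA js:admissible_words d \<beta> r. {l. l \<le> d \<and> 0 < midx_diff \<beta> (count (mset js)) l})
     (admissible_words d \<beta> (Suc r))"
proof (rule bij_betw_byWitness[where f' = "\<lambda>js. (tl js, hd js)"])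
  have "l # js \<in> admissible_words d \<beta> (Suc r) \<longleftrightarrow>
      js \<in> admissible_words d \<beta> r \<and> l \<le> d \<and> 0 < midx_diff \<beta> (count (mset js)) l" for l js
  proof -
    have "count (mset (l # js)) \<le> \<beta> \<longleftrightarrow> count (mset js) \<le> \<beta> \<and> count (mset js) l < \<beta> l"
    proof
      assume le: "count (mset (l # js)) \<le> \<beta>"
      have "count (mset js) i \<le> \<beta> i" for i
        using le_funD[OF le, of i] by (simp split: if_splits)
      moreover have "count (mset js) l < \<beta> l"
        using le_funD[OF le, of l] by simp
      ultimately show "count (mset js) \<le> \<beta> \<and> count (mset js) l < \<beta> l"
        by (simp add: le_fun_def)
    qed (auto simp: le_fun_def)
    then show ?thesis
      by (auto simp: admissible_words_def midx_diff_def)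
  qed
  note Cons_iff = this
  show "(\<lambda>(js, l). l # js) `
      (SIGMA js:admissible_words d \<beta> r. {l. l \<le> d \<and> 0 < midx_diff \<beta> (count (mset js)) l})
      \<subseteq> admissible_words d \<beta> (Suc r)"
    by (auto simp: Cons_iff)
  have ne: "\<exists>l ls. js = l # ls" if "js \<in> admissible_words d \<beta> (Suc r)" for js
    using that by (cases js) (auto simp: admissible_words_def)
  show "\<forall>js\<in>admissible_words d \<beta> (Suc r). (\<lambda>(js, l). l # js) (tl js, hd js) = js"
    using ne by fastforce
  show "(\<lambda>js. (tl js, hd js)) ` admissible_words d \<beta> (Suc r) \<subseteq>
      (SIGMA js:admissible_words d \<beta> r. {l. l \<le> d \<and> 0 < midx_diff \<beta> (count (mset js)) l})"
  proof (rule image_subsetI)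
    fix js assume js: "js \<in> admissible_words d \<beta> (Suc r)"
    then obtain l ls where "js = l # ls"
      using ne by blast
    with js show "(tl js, hd js) \<in>
        (SIGMA js:admissible_words d \<beta> r. {l. l \<le> d \<and> 0 < midx_diff \<beta> (count (mset js)) l})"
      by (simp add: Cons_iff)
  qed
qed auto

text \<open>
  The factor \<open>c\<close> is carried through the induction because \<open>deriv\<close> is known to commute with it only for
  differentiable functions, and differentiability comes from the expansion itself. In the step, the
  new axis is paired with a new first letter, since \<open>iterated_partial\<close> differentiates last along the
  head of the list.
\<close>

lemma iterated_partial_scaled_monomial:
  fixes lam :: "nat \<Rightarrow> real^'d \<Rightarrow> real"
  assumes aff: "\<And>i j x t. i \<le> CARD('d) \<Longrightarrow> lam i (x + t *\<^sub>R axis j 1) = lam i x + t * G i $ j"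
  shows "iterated_partial ix (\<lambda>y. c * scaled_monomial lam \<beta> y) x =
    c * (\<Sum>js\<in>admissible_words CARD('d) \<beta> (length ix).
       tensor_of_vectors (map G js) ix * scaled_monomial lam (midx_diff \<beta> (count (mset js))) x)"
proof (induction ix arbitrary: x)
  case Nil
  have "admissible_words CARD('d) \<beta> 0 = {[]}"
    by (auto simp: admissible_words_def le_fun_def)
  then show ?case
    by (simp add: tensor_of_vectors_def midx_diff_def)
next
  case (Cons j ix)
  let ?A = "admissible_words CARD('d) \<beta>"
  let ?rest = "\<lambda>js. midx_diff \<beta> (count (mset js))"
  let ?L = "\<lambda>js. {l. l \<le> CARD('d) \<and> 0 < ?rest js l}"
  \<comment> \<open>The truncated subtraction makes this hold for all letters, admissible or not.\<close>
  have rest_Cons: "(?rest js)(l := ?rest js l - 1) = ?rest (l # js)" for l js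
    by (auto simp: midx_diff_def fun_eq_iff)
  have "((\<lambda>t. c * (\<Sum>js\<in>?A (length ix). tensor_of_vectors (map G js) ix *
        scaled_monomial lam (?rest js) (x + t *\<^sub>R axis j 1))) has_real_derivative
      c * (\<Sum>js\<in>?A (length ix). tensor_of_vectors (map G js) ix *
        (\<Sum>l\<in>?L js. G l $ j * scaled_monomial lam ((?rest js)(l := ?rest js l - 1)) x))) (at 0)"
    by (intro DERIV_sum DERIV_cmult scaled_monomial_has_derivative aff)
  then have "iterated_partial (j # ix) (\<lambda>y. c * scaled_monomial lam \<beta> y) x =
      c * (\<Sum>js\<in>?A (length ix). tensor_of_vectors (map G js) ix *
        (\<Sum>l\<in>?L js. G l $ j * scaled_monomial lam (?rest (l # js)) x))"
    unfolding rest_Cons by (simp add: partial_deriv_def Cons.IH DERIV_imp_deriv)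
  also have "\<dots> = c * (\<Sum>js\<in>?A (length ix). \<Sum>l\<in>?L js.
      tensor_of_vectors (map G (l # js)) (j # ix) * scaled_monomial lam (?rest (l # js)) x)"
    by (simp add: tensor_of_vectors_Cons sum_distrib_left mult_ac)
  also have "\<dots> = c * (\<Sum>(js, l)\<in>(SIGMA js:?A (length ix). ?L js).
      tensor_of_vectors (map G (l # js)) (j # ix) * scaled_monomial lam (?rest (l # js)) x)"
    by (subst sum.Sigma) (auto simp: finite_admissible_words)
  also have "\<dots> = c * (\<Sum>js\<in>?A (Suc (length ix)).
      tensor_of_vectors (map G js) (j # ix) * scaled_monomial lam (?rest js) x)"
    by (subst sum.reindex_bij_betw[OF admissible_words_Suc, symmetric]) (simp add: case_prod_unfold)
  finally show ?case
    by simp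
qed


section \<open>Derivatives of Bernstein polynomials\<close>

theorem lemma3p6:
  fixes T :: "(real^'d) set"
    and v :: "nat \<Rightarrow> real^'d"
    and lam :: "nat \<Rightarrow> real^'d \<Rightarrow> real"
    and \<beta> :: "nat \<Rightarrow> nat"
    and k r :: nat
  assumes "int CARD('d) simplex T"
    and "bij_betw v {..CARD('d)} {p. p extreme_point_of T}"
    and "barycentric_coordinates v lam"
    and "\<beta> \<in> multi_indices CARD('d) k"
    and "r \<le> k"
  shows "\<forall>x. \<forall>ix. length ix = r \<longrightarrow>
    nabla (bernstein lam \<beta>) x ix =
      (\<Sum>\<alpha> | \<alpha> \<in> multi_indices CARD('d) r \<and> \<alpha> \<le> \<beta>.
         fact r * fact k / (fact (k - r) * midx_fact CARD('d) \<alpha>)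
         * sym_tensor r (tensor_power (\<lambda>i. gradient (lam i) x) \<alpha>) ix
         * bernstein lam (midx_diff \<beta> \<alpha>) x)"
proof (intro allI impI)
  fix x :: "real^'d" and ix :: "'d list"
  assume len: "length ix = r"
  let ?d = "CARD('d)"
  let ?A = "admissible_words ?d \<beta> r"
  define G :: "nat \<Rightarrow> real^'d" where "G i = (\<chi> j. lam i (axis j 1) - lam i 0)" for i
  have aff: "lam i (y + t *\<^sub>R axis j 1) = lam i y + t * G i $ j" if "i \<le> ?d" for i j y t
    using barycentric_coordinates_affine[OF assms(1-3) that] by (simp add: G_def)
  have gradient: "gradient (lam i) x = G i" if "i \<le> ?d" for i
  proof -
    have "((\<lambda>t. lam i x + t * G i $ j) has_real_derivative G i $ j) (at 0)" for j
      by (auto intro!: derivative_eq_intros)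
    then show ?thesis
      by (simp add: gradient_def partial_deriv_def aff[OF that] DERIV_imp_deriv vec_eq_iff)
  qed
  have group_term: "fact k * (\<Sum>js\<in>{js \<in> ?A. count (mset js) = \<alpha>}.
        tensor_of_vectors (map G js) ix * scaled_monomial lam (midx_diff \<beta> (count (mset js))) x) =
      fact r * fact k / (fact (k - r) * midx_fact ?d \<alpha>)
        * sym_tensor r (tensor_power (\<lambda>i. gradient (lam i) x) \<alpha>) ix
        * bernstein lam (midx_diff \<beta> \<alpha>) x"
    if \<alpha>: "\<alpha> \<in> multi_indices ?d r" and le: "\<alpha> \<le> \<beta>" for \<alpha>
  proof -
    let ?w = "sorted_word ?d \<alpha>"
    let ?S = "\<Sum>js\<in>permutations_of_multiset (mset ?w). tensor_of_vectors (map G js) ix"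
    have words: "{js \<in> ?A. count (mset js) = \<alpha>} = permutations_of_multiset (mset ?w)"
      using le by (auto simp: words_with_counts[OF \<alpha>] admissible_words_def)
    have "map (\<lambda>i. gradient (lam i) x) ?w = map G ?w"
      using gradient set_sorted_word[of ?d \<alpha>] by auto
    then have sym_eq: "fact r * sym_tensor r (tensor_power (\<lambda>i. gradient (lam i) x) \<alpha>) ix =
        midx_fact ?d \<alpha> * ?S"
      using sym_tensor_of_vectors[of ix ?w G] len
      by (simp only: tensor_power_eq_sorted_word midx_fact_eq_prod_count[OF \<alpha>] length_sorted_word[OF \<alpha>])
    have "midx_sum ?d (midx_diff \<beta> \<alpha>) = k - r"
      using \<alpha> assms(4) le sum_subtractf_nat[of "{..?d}" \<alpha> \<beta>]
      by (simp add: midx_sum_def midx_diff_def multi_indices_def le_fun_def)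
    then have bern: "bernstein lam (midx_diff \<beta> \<alpha>) x =
        fact (k - r) * scaled_monomial lam (midx_diff \<beta> \<alpha>) x"
      by (rule bernstein_eq_scaled_monomial)
    have pos: "midx_fact ?d \<alpha> \<noteq> 0"
      by (simp add: midx_fact_def)
    have "fact r * fact k / (fact (k - r) * midx_fact ?d \<alpha>)
          * sym_tensor r (tensor_power (\<lambda>i. gradient (lam i) x) \<alpha>) ix
          * bernstein lam (midx_diff \<beta> \<alpha>) x =
        fact k / midx_fact ?d \<alpha>
          * (fact r * sym_tensor r (tensor_power (\<lambda>i. gradient (lam i) x) \<alpha>) ix)
          * scaled_monomial lam (midx_diff \<beta> \<alpha>) x"
      by (simp add: bern)
    also have "\<dots> = fact k * (?S * scaled_monomial lam (midx_diff \<beta> \<alpha>) x)"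
      using pos by (simp add: sym_eq)
    also have "\<dots> = fact k * (\<Sum>js\<in>{js \<in> ?A. count (mset js) = \<alpha>}.
        tensor_of_vectors (map G js) ix * scaled_monomial lam (midx_diff \<beta> \<alpha>) x)"
      by (simp add: words sum_distrib_right)
    also have "\<dots> = fact k * (\<Sum>js\<in>{js \<in> ?A. count (mset js) = \<alpha>}.
        tensor_of_vectors (map G js) ix * scaled_monomial lam (midx_diff \<beta> (count (mset js))) x)"
      by simp
    finally show ?thesis
      by (rule sym)
  qed
  have "bernstein lam \<beta> = (\<lambda>y. fact k * scaled_monomial lam \<beta> y)"
    using assms(4) by (simp add: fun_eq_iff multi_indices_def bernstein_eq_scaled_monomial)
  then have "nabla (bernstein lam \<beta>) x ix = fact k * (\<Sum>js\<in>?A.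
      tensor_of_vectors (map G js) ix * scaled_monomial lam (midx_diff \<beta> (count (mset js))) x)"
    using len by (simp add: nabla_def iterated_partial_scaled_monomial[OF aff])
  also have "\<dots> = (\<Sum>\<alpha> | \<alpha> \<in> multi_indices ?d r \<and> \<alpha> \<le> \<beta>.
      fact k * (\<Sum>js\<in>{js \<in> ?A. count (mset js) = \<alpha>}.
        tensor_of_vectors (map G js) ix * scaled_monomial lam (midx_diff \<beta> (count (mset js))) x))"
    unfolding sum.image_gen[OF finite_admissible_words, where g = "\<lambda>js. count (mset js)"]
      count_mset_admissible_words by (rule sum_distrib_left)
  also have "\<dots> = (\<Sum>\<alpha> | \<alpha> \<in> multi_indices ?d r \<and> \<alpha> \<le> \<beta>.
      fact r * fact k / (fact (k - r) * midx_fact ?d \<alpha>)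
        * sym_tensor r (tensor_power (\<lambda>i. gradient (lam i) x) \<alpha>) ix
        * bernstein lam (midx_diff \<beta> \<alpha>) x)"
    by (intro sum.cong refl group_term) auto
  finally show "nabla (bernstein lam \<beta>) x ix =
      (\<Sum>\<alpha> | \<alpha> \<in> multi_indices ?d r \<and> \<alpha> \<le> \<beta>.
         fact r * fact k / (fact (k - r) * midx_fact ?d \<alpha>)
         * sym_tensor r (tensor_power (\<lambda>i. gradient (lam i) x) \<alpha>) ix
         * bernstein lam (midx_diff \<beta> \<alpha>) x)" .
qed

end
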